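(* Let $L$ be a residuated lattice, let $n\geq 1$ be an integer, and let $F_1$ and $F_2$ be filters of $L$ with $F_1\subseteq F_2$. If $F_1$ is an $n$-fold positive implicative filter of $L$, then so is $F_2$.
   Context: A residuated lattice is an algebra $(L,\wedge,\vee,\otimes,\rightarrow,0,1)$ such that $(L,\wedge,\vee,0,1)$ is a bounded lattice, $(L,\otimes,1)$ is a commutative monoid, and $x\otimes y\leq z$ iff $x\leq y\rightarrow z$. A filter of $L$ is a nonempty subset $F$ closed under $\otimes$ and upward closed. For $x\in L$, $x^n=x\otimes\cdots\otimes x$ ($n$ factors). A subset $F\subseteq L$ is an $n$-fold positive implicative filter if $1\in F$ and for all $x,y,z\in L$: if $x\rightarrow((y^n\rightarrow z)\rightarrow y)\in F$ and $x\in F$, then $y\in F$. *)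

theory Defs
  imports Main
begin

text \<open>The constants 0 and 1 of the bounded lattice are \<^const>\<open>bot\<close> and \<^const>\<open>top\<close>; the
  monoid operation and its powers are those of \<^class>\<open>comm_monoid_mult\<close>, whose unit is
  required to coincide with the lattice top.\<close>

class residuated_lattice = bounded_lattice + comm_monoid_mult +
  fixes residuum :: "'a \<Rightarrow> 'a \<Rightarrow> 'a"  (infixr \<open>\<rightarrow>\<^sub>R\<close> 60)
  assumes one_eq_top: "1 = top"
    and residuation: "x * y \<le> z \<longleftrightarrow> x \<le> y \<rightarrow>\<^sub>R z"

definition residuated_filter :: "'a::residuated_lattice set \<Rightarrow> bool" where
  "residuated_filter F \<longleftrightarrow>
     F \<noteq> {} \<and> (\<forall>x\<in>F. \<forall>y\<in>F. x * y \<in> F) \<and> (\<forall>x\<in>F. \<forall>y. x \<le> y \<longrightarrow> y \<in> F)"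

definition nfold_positive_implicative_filter ::
    "nat \<Rightarrow> 'a::residuated_lattice set \<Rightarrow> bool" where
  "nfold_positive_implicative_filter n F \<longleftrightarrow>
     1 \<in> F \<and>
     (\<forall>x y z. x \<rightarrow>\<^sub>R ((y ^ n \<rightarrow>\<^sub>R z) \<rightarrow>\<^sub>R y) \<in> F \<and> x \<in> F \<longrightarrow> y \<in> F)"

end

theory Submission
  imports Defs
begin

text \<open>An \<open>n\<close>-fold positive implicative filter contains \<open>y \<squnion> (y\<^sup>n \<rightarrow> 0)\<close> for every \<open>y\<close>, and this
  property is inherited by larger sets. Conversely, a filter with this property is \<open>n\<close>-fold
  positive implicative: if \<open>u = (y\<^sup>n \<rightarrow> z) \<rightarrow> y\<close> lies in the filter, both \<open>y\<close> and \<open>y\<^sup>n \<rightarrow> 0\<close> are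
  below \<open>u \<rightarrow> y\<close>, hence \<open>u \<rightarrow> y\<close> and then \<open>y\<close> lie in the filter.\<close>

context residuated_lattice
begin

lemma le_one: "x \<le> 1"
  by (simp add: one_eq_top)

text \<open>By residuation, multiplication by \<open>z\<close> is left adjoint to
  \<open>residuum z\<close>, hence monotone; the proof uses the unit of this adjunction.\<close>

lemma mult_right_mono_residuated:
  assumes "x \<le> y"
  shows "x * z \<le> y * z"
proof -
  have "y \<le> z \<rightarrow>\<^sub>R (y * z)"
    by (simp flip: residuation)
  with assms have "x \<le> z \<rightarrow>\<^sub>R (y * z)"
    by (rule order_trans)
  then show ?thesis
    by (simp add: residuation)
qed

lemma mult_mono_residuated:
  assumes "x \<le> y" and "z \<le> w"
  shows "x * z \<le> y * w"
proof -
  have "x * z \<le> y * z"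
    using assms(1) by (rule mult_right_mono_residuated)
  also have "y * z \<le> y * w"
    using mult_right_mono_residuated[OF assms(2), of y] by (simp add: mult.commute)
  finally show ?thesis .
qed

lemma power_mono_residuated:
  assumes "x \<le> y"
  shows "x ^ n \<le> y ^ n"
  using assms by (induction n) (auto intro: mult_mono_residuated)

lemma residuum_mult_le: "(x \<rightarrow>\<^sub>R y) * x \<le> y"
  by (simp add: residuation)

lemma residuum_mono:
  assumes "x' \<le> x" and "y \<le> y'"
  shows "x \<rightarrow>\<^sub>R y \<le> x' \<rightarrow>\<^sub>R y'"
proof -
  have "(x \<rightarrow>\<^sub>R y) * x' \<le> (x \<rightarrow>\<^sub>R y) * x"
    using assms(1) by (simp add: mult_mono_residuated)
  also have "\<dots> \<le> y"
    by (rule residuum_mult_le)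
  also have "\<dots> \<le> y'"
    by (rule assms(2))
  finally show ?thesis
    by (simp add: residuation)
qed

lemma residuum_eq_one:
  assumes "x \<le> y"
  shows "x \<rightarrow>\<^sub>R y = 1"
  using assms by (intro order.antisym le_one) (simp flip: residuation)

lemma le_residuum: "y \<le> x \<rightarrow>\<^sub>R y"
  using mult_mono_residuated[OF order_refl le_one, of y x] by (simp flip: residuation)

end

lemma residuated_filter_one:
  assumes "residuated_filter F"
  shows "1 \<in> F"
  using assms le_one unfolding residuated_filter_def by blast

lemma residuated_filter_upward:
  assumes "residuated_filter F" and "x \<in> F" and "x \<le> y"
  shows "y \<in> F"
  using assms unfolding residuated_filter_def by blast

lemma residuated_filter_mp:
  assumes "residuated_filter F" and "x \<rightarrow>\<^sub>R y \<in> F" and "x \<in> F"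
  shows "y \<in> F"
proof -
  have "(x \<rightarrow>\<^sub>R y) * x \<in> F"
    using assms unfolding residuated_filter_def by blast
  then show ?thesis
    by (rule residuated_filter_upward[OF assms(1) _ residuum_mult_le])
qed

text \<open>The supremum \<open>a\<close> absorbs its own
  \<open>a ^ n \<rightarrow>\<^sub>R bot\<close>, so the defining condition applies to
  \<open>a\<close> itself with \<open>x = 1\<close> and \<open>z = bot\<close>.\<close>

lemma nfold_positive_implicative_filter_sup_in:
  fixes y :: "'a::residuated_lattice"
  assumes "nfold_positive_implicative_filter n F"
  shows "sup y (y ^ n \<rightarrow>\<^sub>R bot) \<in> F"
proof -
  define a where "a = sup y (y ^ n \<rightarrow>\<^sub>R bot)"
  \<comment> \<open>Residuum is antitone in its first argument, and
    \<open>y \<le> a\<close>.\<close>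
  have "a ^ n \<rightarrow>\<^sub>R bot \<le> y ^ n \<rightarrow>\<^sub>R bot"
    by (intro residuum_mono power_mono_residuated) (simp_all add: a_def)
  also have "\<dots> \<le> a"
    by (simp add: a_def)
  finally have "1 \<rightarrow>\<^sub>R ((a ^ n \<rightarrow>\<^sub>R bot) \<rightarrow>\<^sub>R a) = 1"
    by (simp add: residuum_eq_one)
  then have "a \<in> F"
    using assms unfolding nfold_positive_implicative_filter_def by metis
  then show ?thesis
    by (simp add: a_def)
qed

lemma nfold_positive_implicative_filterI:
  fixes F :: "'a::residuated_lattice set"
  assumes F: "residuated_filter F"
    and sup_in: "\<And>y. sup y (y ^ n \<rightarrow>\<^sub>R bot) \<in> F"
  shows "nfold_positive_implicative_filter n F"
  unfolding nfold_positive_implicative_filter_def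
proof (intro conjI allI impI)
  show "1 \<in> F"
    using F by (rule residuated_filter_one)
next
  fix x y z
  assume "x \<rightarrow>\<^sub>R ((y ^ n \<rightarrow>\<^sub>R z) \<rightarrow>\<^sub>R y) \<in> F \<and> x \<in> F"
  then have u: "(y ^ n \<rightarrow>\<^sub>R z) \<rightarrow>\<^sub>R y \<in> F" (is "?u \<in> F")
    using residuated_filter_mp[OF F] by blast
  \<comment> \<open>As \<open>bot \<le> z\<close>, passing from \<open>z\<close> to
    \<open>bot\<close> shrinks the inner residuum and so enlarges the outer one.\<close>
  have "?u \<le> (y ^ n \<rightarrow>\<^sub>R bot) \<rightarrow>\<^sub>R y"
    by (intro residuum_mono) simp_all
  \<comment> \<open>Exchange of premises: both inequalities say that the product of
    \<open>?u\<close> and \<open>y ^ n \<rightarrow>\<^sub>R bot\<close> is below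
    \<open>y\<close>.\<close>
  then have "y ^ n \<rightarrow>\<^sub>R bot \<le> ?u \<rightarrow>\<^sub>R y"
    by (simp add: mult.commute flip: residuation)
  then have "sup y (y ^ n \<rightarrow>\<^sub>R bot) \<le> ?u \<rightarrow>\<^sub>R y"
    by (simp add: le_residuum)
  then have "?u \<rightarrow>\<^sub>R y \<in> F"
    by (rule residuated_filter_upward[OF F sup_in])
  then show "y \<in> F"
    using u by (rule residuated_filter_mp[OF F])
qed

theorem theorem5p6:
  fixes F1 F2 :: "'a::residuated_lattice set" and n :: nat
  assumes "n \<ge> 1"
    and "residuated_filter F1"
    and "residuated_filter F2"
    and "F1 \<subseteq> F2"
    and "nfold_positive_implicative_filter n F1"
  shows "nfold_positive_implicative_filter n F2"
proof (rule nfold_positive_implicative_filterI)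
  show "residuated_filter F2"
    by fact
  show "sup y (y ^ n \<rightarrow>\<^sub>R bot) \<in> F2" for y
    using nfold_positive_implicative_filter_sup_in assms(4,5) by blast
qed

end
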